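(* The competitive ratio of any deterministic online algorithm for Online Sum-Radii Clustering in the Euclidean plane is $\Omega(\log n)$, where $n$ is the number of demands.
   Context: Online Sum-Radii Clustering in the Euclidean plane: the metric space is $\mathbb{R}^2$ with Euclidean distance $d$, and $f>0$ is the opening cost. Demand points $u_1,\dots,u_n\in\mathbb{R}^2$ arrive one by one; upon arrival of $u_j$, if $u_j$ is not contained in an already opened cluster, the algorithm must irrevocably open a new cluster $C(p,r)=\{v:d(p,v)\le r\}$ containing $u_j$ (fixing center $p$ and radius $r$) at cost $f+r$. An algorithm is $c$-competitive if for every demand sequence its cost is at most $c$ times the optimal offline cost, i.e. the minimum of $\sum_i(f+r_i)$ over collections of clusters $C(p_i,r_i)$ covering all demands. *)

theory Defs
  imports "HOL-Analysis.Analysis"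
begin

type_synonym point = "real ^ 2"

text \<open>The pair \<open>(p, r)\<close> stands for the cluster \<open>C(p, r) = cball p r\<close>.\<close>
type_synonym cluster = "point \<times> real"

definition covered :: "cluster list \<Rightarrow> point \<Rightarrow> bool" where
  "covered C u \<longleftrightarrow> (\<exists>(p, r) \<in> set C. u \<in> cball p r)"

definition clustering_cost :: "real \<Rightarrow> cluster list \<Rightarrow> real" where
  "clustering_cost f C = (\<Sum>(p, r) \<leftarrow> C. f + r)"

text \<open>Radii of offline clusters are required to be nonnegative, since a pair with a negative
  radius would denote an empty cluster and contribute a cost below \<open>f\<close>.\<close>
definition offline_solution :: "point list \<Rightarrow> cluster list \<Rightarrow> bool" where
  "offline_solution us C \<longleftrightarrow> (\<forall>(p, r) \<in> set C. 0 \<le> r) \<and> (\<forall>u \<in> set us. covered C u)"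

definition opt_cost :: "real \<Rightarrow> point list \<Rightarrow> real" where
  "opt_cost f us = Inf {clustering_cost f C | C. offline_solution us C}"

text \<open>A deterministic online algorithm is a function of the demands seen so far. Its value on
  \<open>[u\<^sub>1, \<dots>, u\<^sub>j]\<close> is the cluster it opens when \<open>u\<^sub>j\<close> arrives uncovered; the clusters opened
  earlier are determined by the same prefix and hence need not be an argument.\<close>
type_synonym online_algorithm = "point list \<Rightarrow> cluster"

text \<open>The clusters open after the first \<open>j\<close> demands of \<open>us\<close>, for \<open>j \<le> length us\<close>.\<close>
primrec opened :: "online_algorithm \<Rightarrow> point list \<Rightarrow> nat \<Rightarrow> cluster list" where
  "opened A us 0 = []"
| "opened A us (Suc j) =
     (if covered (opened A us j) (us ! j) then opened A us j
      else opened A us j @ [A (take (Suc j) us)])"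

text \<open>Validity also forces the radii of all opened clusters to be nonnegative.\<close>
definition valid_algorithm :: "online_algorithm \<Rightarrow> bool" where
  "valid_algorithm A \<longleftrightarrow>
     (\<forall>us j. j < length us \<longrightarrow> \<not> covered (opened A us j) (us ! j) \<longrightarrow>
        (case A (take (Suc j) us) of (p, r) \<Rightarrow> us ! j \<in> cball p r))"

definition online_cost :: "real \<Rightarrow> online_algorithm \<Rightarrow> point list \<Rightarrow> real" where
  "online_cost f A us = clustering_cost f (opened A us (length us))"

definition competitive_on :: "real \<Rightarrow> online_algorithm \<Rightarrow> nat \<Rightarrow> real \<Rightarrow> bool" where
  "competitive_on f A n c \<longleftrightarrow>
     (\<forall>us. length us = n \<longrightarrow> online_cost f A us \<le> c * opt_cost f us)"

text \<open>The competitive ratio as a function of the number \<open>n\<close> of demands; it is \<open>\<infinity>\<close> if no real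
  \<open>c\<close> works.\<close>
definition competitive_ratio :: "real \<Rightarrow> online_algorithm \<Rightarrow> nat \<Rightarrow> ereal" where
  "competitive_ratio f A n = Inf {ereal c | c. competitive_on f A n c}"

end

theory Submission
  imports Defs
begin

text \<open>
  The adversary works on a quinary tree of discs: the five children of a disc of radius
  \<open>4\<^sup>k\<^sup>+\<^sup>1 f\<close> are discs of radius \<open>4\<^sup>k f\<close> at mutual distance at least \<open>4\<^sup>k f\<close>, and the leaves
  are single demands. It traverses the tree depth first and skips every disc that meets a cluster
  already open. Let \<open>N\<^sub>k\<close> be the number of visited discs of level \<open>k\<close>; covering these gives
  \<open>OPT \<le> 2 f 4\<^sup>k N\<^sub>k\<close> for every \<open>k\<close>. If some demand in a visited disc of level \<open>k + 1\<close> triggers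
  a cluster of radius at least \<open>4\<^sup>k f / 2\<close>, we charge \<open>4\<^sup>k\<^sup>+\<^sup>1\<close> to that cluster; otherwise no
  cluster reaches from one child to another and all five children are visited. As \<open>5 > 4\<close>, the sum
  of \<open>4\<^sup>k N\<^sub>k\<close> over all levels is at most a constant times the total charge. The charges to one
  cluster form a geometric series, so this is \<open>O(ALG / f)\<close>. Thus the cost of the algorithm is
  at least of the order of \<open>OPT\<close> times the number of levels, which is logarithmic in \<open>n\<close>.
\<close>

section \<open>Runs of online algorithms\<close>

lemma clustering_cost_append [simp]:
  "clustering_cost f (C @ D) = clustering_cost f C + clustering_cost f D"
  by (simp add: clustering_cost_def)

abbreviation opened_all :: "online_algorithm \<Rightarrow> point list \<Rightarrow> cluster list" where
  "opened_all A us \<equiv> opened A us (length us)"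

lemma opened_append: "j \<le> length us \<Longrightarrow> opened A (us @ vs) j = opened A us j"
  by (induction j) (auto simp: nth_append)

lemma opened_all_snoc:
  "opened_all A (us @ [u]) =
     (if covered (opened_all A us) u then opened_all A us else opened_all A us @ [A (us @ [u])])"
  by (simp add: opened_append)

lemma valid_algorithm_opens:
  assumes "valid_algorithm A" "\<not> covered (opened_all A us) u" "A (us @ [u]) = (q, r)"
  shows "u \<in> cball q r" "0 \<le> r"
proof -
  show "u \<in> cball q r"
    using assms unfolding valid_algorithm_def
    by (auto dest!: spec[of _ "us @ [u]"] spec[of _ "length us"] simp: opened_append)
  then show "0 \<le> r"
    using zero_le_dist[of q u] by (simp del: zero_le_dist)
qed

text \<open>Needed to pad a demand sequence to a prescribed length: validity makes every radius
  opened on the way nonnegative, so the cost cannot drop.\<close>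

lemma online_cost_append:
  assumes "valid_algorithm A" "0 \<le> f"
  shows "online_cost f A us \<le> online_cost f A (us @ vs)"
proof (induction vs rule: rev_induct)
  case (snoc v vs)
  have "opened_all A ((us @ vs) @ [v]) =
     (if covered (opened_all A (us @ vs)) v then opened_all A (us @ vs)
      else opened_all A (us @ vs) @ [A ((us @ vs) @ [v])])"
    by (rule opened_all_snoc)
  moreover obtain q r where qr: "A ((us @ vs) @ [v]) = (q, r)"
    by fastforce
  moreover have "0 \<le> r" if "\<not> covered (opened_all A (us @ vs)) v"
    using valid_algorithm_opens(2)[OF assms(1) that qr] .
  ultimately have "online_cost f A (us @ vs) \<le> online_cost f A ((us @ vs) @ [v])"
    using assms(2) unfolding online_cost_def by (auto simp: clustering_cost_def)
  then show ?case
    using snoc.IH by simp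
qed simp

section \<open>The offline optimum\<close>

text \<open>Some cluster must cover the first demand, and it alone costs at least \<open>f\<close>.
  This bounds the set in \<open>opt_cost\<close> from below and later makes the optimum
  positive.\<close>

lemma clustering_cost_ge:
  assumes "offline_solution us C" "us \<noteq> []" "0 \<le> f"
  shows "f \<le> clustering_cost f C"
proof -
  obtain c where c: "c \<in> set C"
    using assms(1,2) unfolding offline_solution_def covered_def
    by (metis list.set_sel(1))
  have nonneg: "\<forall>(p, r) \<in> set C. 0 \<le> r"
    using assms(1) by (simp add: offline_solution_def)
  have "f \<le> (case c of (p, r) \<Rightarrow> f + r)"
    using nonneg c by auto
  also have "\<dots> \<le> (\<Sum>(p, r) \<leftarrow> C. f + r)"
  proof (rule member_le_sum_list)
    show "(case c of (p, r) \<Rightarrow> f + r) \<in> set (map (\<lambda>(p, r). f + r) C)"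
      using c by auto
  next
    fix x assume "x \<in> set (map (\<lambda>(p, r). f + r) C)"
    then show "0 \<le> x"
      using nonneg assms(3) by fastforce
  qed
  finally show ?thesis
    by (simp add: clustering_cost_def)
qed

lemma opt_cost_le:
  assumes "offline_solution us C" "us \<noteq> []" "0 \<le> f"
  shows "opt_cost f us \<le> clustering_cost f C"
  unfolding opt_cost_def using assms clustering_cost_ge
  by (intro cInf_lower bdd_belowI[of _ f]) blast+

lemma opt_cost_le_cball_cover:
  assumes "set us \<subseteq> (\<Union>c\<in>set cs. cball c R)" "us \<noteq> []" "0 \<le> f" "0 \<le> R"
  shows "opt_cost f us \<le> real (length cs) * (f + R)"
proof -
  let ?C = "map (\<lambda>c. (c, R)) cs"
  have "offline_solution us ?C"
    using assms(1,4) unfolding offline_solution_def covered_def by fastforce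
  moreover have "clustering_cost f ?C = real (length cs) * (f + R)"
    by (simp add: clustering_cost_def comp_def sum_list_triv)
  ultimately show ?thesis
    using opt_cost_le assms(2,3) by fastforce
qed

lemma opt_cost_ge:
  assumes "us \<noteq> []" "0 \<le> f"
  shows "f \<le> opt_cost f us"
  unfolding opt_cost_def
proof (rule cInf_greatest)
  have "offline_solution us (map (\<lambda>u. (u, 0)) us)"
    by (force simp: offline_solution_def covered_def)
  then show "{clustering_cost f C | C. offline_solution us C} \<noteq> {}"
    by blast
qed (use assms clustering_cost_ge in blast)

section \<open>Charging clusters\<close>

text \<open>The \<open>1\<close> pays for the leaf demand that opens the cluster; term
  \<open>j\<close> can pay for the visited disc of level \<open>j + 1\<close> containing that
  demand. Truncating at \<open>k\<close> lets each step up the tree add one term.\<close>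

definition charge :: "real \<Rightarrow> nat \<Rightarrow> real \<Rightarrow> real" where
  "charge f k r = 1 + (\<Sum>j<k. if f * 4 ^ j / 2 \<le> r then 4 ^ Suc j else 0)"

lemma charge_Suc:
  "charge f (Suc k) r = charge f k r + (if f * 4 ^ k / 2 \<le> r then 4 ^ Suc k else 0)"
  by (simp add: charge_def)

text \<open>Even with all terms present, the geometric sum is
  \<open>(4 ^ Suc k - 1) / 3\<close>.\<close>

lemma charge_le_power: "charge f k r \<le> 4 / 3 * 4 ^ k"
proof (induction k)
  case (Suc k)
  have "charge f (Suc k) r \<le> charge f k r + 4 * 4 ^ k"
    by (simp add: charge_Suc)
  also have "\<dots> \<le> 4 / 3 * 4 ^ Suc k"
    using Suc.IH by simp
  finally show ?case .
qed (simp add: charge_def)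

lemma charge_le_cost:
  assumes "0 < f" "0 \<le> r"
  shows "charge f k r \<le> 11 * (f + r) / f"
proof (induction k)
  case 0
  then show ?case
    using assms by (simp add: charge_def field_simps)
next
  case (Suc k)
  show ?case
  proof (cases "f * 4 ^ k / 2 \<le> r")
    case True
    \<comment> \<open>The last term is active, so \<open>4 ^ k \<le> 2 * r / f\<close> and the whole
      sum is at most \<open>32 / 3 * r / f\<close>; 11 rounds 32/3 up.\<close>
    have "charge f (Suc k) r \<le> 16 / 3 * 4 ^ k"
      using charge_le_power[of f "Suc k" r] by simp
    also have "\<dots> \<le> 11 * (f + r) / f"
      using True assms by (simp add: field_simps)
    finally show ?thesis .
  next
    case False
    then show ?thesis
      using Suc by (simp add: charge_Suc)
  qed
qed

section \<open>The adversary\<close>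

definition fresh :: "cluster list \<Rightarrow> point set \<Rightarrow> bool" where
  "fresh C P \<longleftrightarrow> (\<forall>(q, r) \<in> set C. cball q r \<inter> P = {})"

lemma fresh_append: "fresh (C @ D) P \<longleftrightarrow> fresh C P \<and> fresh D P"
  by (auto simp: fresh_def)

lemma fresh_mono: "fresh C P \<Longrightarrow> Q \<subseteq> P \<Longrightarrow> fresh C Q"
  unfolding fresh_def by blast

text \<open>After the demands \<open>us\<close>, the adversary continues with demands \<open>vs\<close> in the region \<open>P\<close>, and the
  algorithm responds with the clusters \<open>D\<close>. Here \<open>N j\<close> is the number of visited discs of
  level \<open>j\<close>.\<close>
definition attack ::
  "real \<Rightarrow> online_algorithm \<Rightarrow> nat \<Rightarrow> point list \<Rightarrow> point set \<Rightarrow> point list \<Rightarrow> cluster list \<Rightarrow>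
   (nat \<Rightarrow> nat) \<Rightarrow> bool" where
  "attack f A k us P vs D N \<longleftrightarrow>
     opened_all A (us @ vs) = opened_all A us @ D \<and>
     (\<forall>(q, r) \<in> set D. 0 \<le> r \<and> cball q r \<inter> P \<noteq> {}) \<and>
     set vs \<subseteq> P \<and>
     (\<forall>j\<le>k. \<exists>cs. length cs = N j \<and> set vs \<subseteq> (\<Union>c\<in>set cs. cball c (f * 4 ^ j))) \<and>
     1 / 5 * (\<Sum>j<k. 4 ^ j * real (N j)) + 4 ^ k * real (N k) \<le> (\<Sum>(q, r) \<leftarrow> D. charge f k r)"

lemma attack_Nil: "attack f A k us P [] [] (\<lambda>_. 0)"
  by (simp add: attack_def)

lemma attack_mono:
  assumes "attack f A k us P vs D N" "P \<subseteq> Q"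
  shows "attack f A k us Q vs D N"
  using assms unfolding attack_def by blast

lemma attack_append:
  assumes "attack f A k us P vs D N" "attack f A k (us @ vs) P vs' D' N'"
  shows "attack f A k us P (vs @ vs') (D @ D') (\<lambda>j. N j + N' j)"
proof -
  have "\<exists>cs. length cs = N j + N' j \<and> set (vs @ vs') \<subseteq> (\<Union>c\<in>set cs. cball c (f * 4 ^ j))"
    if j: "j \<le> k" for j
  proof -
    obtain cs where cs: "length cs = N j" "set vs \<subseteq> (\<Union>c\<in>set cs. cball c (f * 4 ^ j))"
      using assms(1) j unfolding attack_def by blast
    obtain cs' where cs': "length cs' = N' j" "set vs' \<subseteq> (\<Union>c\<in>set cs'. cball c (f * 4 ^ j))"
      using assms(2) j unfolding attack_def by blast
    show ?thesis
      using cs cs' by (intro exI[of _ "cs @ cs'"]) auto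
  qed
  moreover have "(\<Sum>j<k. 4 ^ j * real (N j + N' j)) =
      (\<Sum>j<k. 4 ^ j * real (N j)) + (\<Sum>j<k. 4 ^ j * real (N' j))"
    by (simp add: algebra_simps sum.distrib)
  ultimately show ?thesis
    using assms unfolding attack_def by (auto simp: algebra_simps)
qed

text \<open>A cluster meeting both discs would give a path from \<open>p\<close> through
  \<open>q\<close> to \<open>p'\<close> of length at most \<open>2 * R + 2 * r\<close>, which is
  below \<open>3 * R\<close>.\<close>

lemma small_cluster_fresh:
  fixes p p' q :: point
  assumes "3 * R \<le> dist p p'" "r < R / 2" "cball q r \<inter> cball p R \<noteq> {}"
  shows "cball q r \<inter> cball p' R = {}"
proof (rule ccontr)
  assume "cball q r \<inter> cball p' R \<noteq> {}"
  then obtain x' where x': "dist q x' \<le> r" "dist p' x' \<le> R"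
    by auto
  obtain x where x: "dist q x \<le> r" "dist p x \<le> R"
    using assms(3) by auto
  have "dist p p' \<le> dist p x + dist q x + dist q x' + dist p' x'"
    by metric
  then show False
    using assms x x' by linarith
qed

text \<open>The hypothesis on a single disc enters as \<open>attack_one\<close>, for arbitrary
  histories. Freshness guards only the last conjunct: a large cluster may spoil later siblings, but
  the other bounds must survive the skipping.\<close>

lemma attack_siblings:
  assumes attack_one: "\<And>us p. fresh (opened_all A us) (cball p (f * 4 ^ k)) \<Longrightarrow>
      \<exists>vs D N. attack f A k us (cball p (f * 4 ^ k)) vs D N \<and> N k = 1 \<and>
        length vs \<le> 5 ^ k \<and> vs \<noteq> []"
    and "sorted_wrt (\<lambda>p p'. 3 * (f * 4 ^ k) \<le> dist p p') ps"
  shows "\<exists>vs D N. attack f A k us (\<Union>p\<in>set ps. cball p (f * 4 ^ k)) vs D N \<and>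
      length vs \<le> length ps * 5 ^ k \<and>
      ((\<forall>p\<in>set ps. fresh (opened_all A us) (cball p (f * 4 ^ k))) \<longrightarrow>
        (N k = length ps \<or> (\<exists>(q, r)\<in>set D. f * 4 ^ k / 2 \<le> r)) \<and> (ps \<noteq> [] \<longrightarrow> vs \<noteq> []))"
  using assms(2)
proof (induction ps arbitrary: us)
  case Nil
  show ?case
    by (rule exI[of _ "[]"], rule exI[of _ "[]"], rule exI[of _ "\<lambda>_. 0"]) (simp add: attack_Nil)
next
  case (Cons p ps)
  let ?B = "\<lambda>p. cball p (f * 4 ^ k)"
  let ?P = "\<Union>p\<in>set (p # ps). ?B p"
  have sorted: "sorted_wrt (\<lambda>p p'. 3 * (f * 4 ^ k) \<le> dist p p') ps"
    using Cons.prems by simp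
  show ?case
  proof (cases "fresh (opened_all A us) (?B p)")
    \<comment> \<open>The disc meets an open cluster, so it is skipped.\<close>
    case False
    obtain vs D N where vs: "attack f A k us (\<Union>p\<in>set ps. ?B p) vs D N"
        "length vs \<le> length ps * 5 ^ k"
      using Cons.IH[OF sorted] by blast
    have "attack f A k us ?P vs D N"
      using attack_mono[OF vs(1)] by auto
    moreover have "length vs \<le> length (p # ps) * 5 ^ k"
      using vs(2) by simp
    ultimately show ?thesis
      using False by (intro exI[of _ vs] exI[of _ D] exI[of _ N]) auto
  next
    case True
    obtain vs D N where vs: "attack f A k us (?B p) vs D N" "N k = 1"
        "length vs \<le> 5 ^ k" "vs \<noteq> []"
      using attack_one[OF True] by blast
    obtain vs' D' N' where vs': "attack f A k (us @ vs) (\<Union>p\<in>set ps. ?B p) vs' D' N'"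
        "length vs' \<le> length ps * 5 ^ k"
        "(\<forall>p\<in>set ps. fresh (opened_all A (us @ vs)) (?B p)) \<longrightarrow>
          N' k = length ps \<or> (\<exists>(q, r)\<in>set D'. f * 4 ^ k / 2 \<le> r)"
      using Cons.IH[OF sorted, of "us @ vs"] by blast
    have "attack f A k us ?P (vs @ vs') (D @ D') (\<lambda>j. N j + N' j)"
      using attack_mono[OF vs(1), of ?P] attack_mono[OF vs'(1), of ?P]
      by (intro attack_append) auto
    moreover have "length (vs @ vs') \<le> length (p # ps) * 5 ^ k"
      using vs(3) vs'(2) by simp
    moreover have "N k + N' k = length (p # ps) \<or> (\<exists>(q, r)\<in>set (D @ D'). f * 4 ^ k / 2 \<le> r)"
      if all_fresh: "\<forall>p\<in>set (p # ps). fresh (opened_all A us) (?B p)"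
    proof (cases "\<exists>(q, r)\<in>set D. f * 4 ^ k / 2 \<le> r")
      case True
      then show ?thesis
        by auto
    next
      case False
      \<comment> \<open>All clusters opened during the attack on \<open>p\<close> are small and meet
        its disc, so none reaches a sibling.\<close>
      have "fresh (opened_all A (us @ vs)) (?B p')" if p': "p' \<in> set ps" for p'
      proof -
        have "3 * (f * 4 ^ k) \<le> dist p p'"
          using Cons.prems p' by simp
        have "cball q r \<inter> ?B p' = {}" if qr: "(q, r) \<in> set D" for q r
        proof (rule small_cluster_fresh[OF \<open>3 * (f * 4 ^ k) \<le> dist p p'\<close>])
          show "r < f * 4 ^ k / 2"
            using False qr by force
          show "cball q r \<inter> ?B p \<noteq> {}"
            using vs(1) qr unfolding attack_def by blast
        qed
        then have "fresh D (?B p')"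
          by (auto simp: fresh_def)
        moreover have "fresh (opened_all A us) (?B p')"
          using all_fresh p' by simp
        moreover have "opened_all A (us @ vs) = opened_all A us @ D"
          using vs(1) by (simp add: attack_def)
        ultimately show ?thesis
          by (simp add: fresh_append)
      qed
      then show ?thesis
        using vs'(3) vs(2) by auto
    qed
    ultimately show ?thesis
      using vs(4)
      by (intro exI[of _ "vs @ vs'"] exI[of _ "D @ D'"] exI[of _ "\<lambda>j. N j + N' j"]) auto
  qed
qed

section \<open>Five separated subdiscs of a disc\<close>

definition children :: "real \<Rightarrow> point \<Rightarrow> point list" where
  "children R p = map (\<lambda>v. p + (3 * R) *\<^sub>R v) [0, axis 1 1, axis 2 1, - axis 1 1, - axis 2 1]"

lemma length_children [simp]: "length (children R p) = 5"
  by (simp add: children_def)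

text \<open>Any two of the five offsets differ by at least 1 in some coordinate, and scaling by
  \<open>3 * R\<close> turns this into the required distance. Discs of radius \<open>R\<close> then
  leave gaps of at least \<open>R\<close>.\<close>

lemma separated_children:
  assumes "0 \<le> R"
  shows "sorted_wrt (\<lambda>p p'. 3 * R \<le> dist p p') (children R p)"
proof -
  let ?vs = "[0, axis 1 1, axis 2 1, - axis 1 1, - axis 2 1] :: point list"
  have "3 * R \<le> dist (p + (3 * R) *\<^sub>R v) (p + (3 * R) *\<^sub>R w)"
    if i: "1 \<le> \<bar>v $ i - w $ i\<bar>" for v w :: point and i
  proof -
    have "1 \<le> norm (v - w)"
      using component_le_norm_cart[of "v - w" i] i by simp
    then have "3 * R * 1 \<le> 3 * R * norm (v - w)"
      using assms by (intro mult_left_mono) auto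
    also have "\<dots> = dist (p + (3 * R) *\<^sub>R v) (p + (3 * R) *\<^sub>R w)"
      using assms by (simp add: dist_norm flip: scaleR_diff_right)
    finally show ?thesis
      by simp
  qed
  moreover have "(\<exists>i. Q i) \<longleftrightarrow> Q 1 \<or> Q 2" for Q :: "2 \<Rightarrow> bool"
    using forall_2[of "\<lambda>i. \<not> Q i"] by blast
  then have "sorted_wrt (\<lambda>v w. \<exists>i. 1 \<le> \<bar>v $ i - w $ i\<bar>) ?vs"
    by (simp add: axis_def)
  ultimately show ?thesis
    unfolding children_def sorted_wrt_map by (blast intro: sorted_wrt_mono_rel[rotated])
qed

lemma cball_children:
  assumes "0 \<le> R" "p' \<in> set (children R p)"
  shows "cball p' R \<subseteq> cball p (4 * R)"
proof -
  have "dist p p' \<le> 3 * R"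
    using assms by (auto simp: children_def dist_norm)
  then show ?thesis
    by (simp add: cball_subset_cball_iff dist_commute)
qed

section \<open>Recursive attack on a disc\<close>

lemma attack_exists:
  assumes "0 < f" "valid_algorithm A" "fresh (opened_all A us) (cball p (f * 4 ^ k))"
  shows "\<exists>vs D N. attack f A k us (cball p (f * 4 ^ k)) vs D N \<and> N k = 1 \<and>
    length vs \<le> 5 ^ k \<and> vs \<noteq> []"
  using assms(3)
\<comment> \<open>The history varies because each child is attacked after the demands in its
  predecessors.\<close>
proof (induction k arbitrary: us p)
  case 0
  \<comment> \<open>A leaf is one demand at the center; the charge 1 of the cluster it opens pays
    for it.\<close>
  have not_covered: "\<not> covered (opened_all A us) p"
    using 0 assms(1) unfolding fresh_def covered_def by fastforce
  obtain q r where qr: "A (us @ [p]) = (q, r)"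
    by fastforce
  have "p \<in> cball q r" "0 \<le> r"
    using valid_algorithm_opens[OF assms(2) not_covered qr] .
  moreover have "opened_all A (us @ [p]) = opened_all A us @ [(q, r)]"
    using not_covered by (simp only: opened_all_snoc qr if_False)
  moreover have "p \<in> cball p (f * 4 ^ 0)"
    using assms(1) by simp
  ultimately have "attack f A 0 us (cball p (f * 4 ^ 0)) [p] [(q, r)] (\<lambda>_. 1)"
    unfolding attack_def by (auto simp: charge_def intro!: exI[of _ "[p]"])
  then show ?case
    by (intro exI[of _ "[p]"] exI[of _ "[(q, r)]"] exI[of _ "\<lambda>_. 1"]) simp
next
  case (Suc k)
  let ?R = "f * 4 ^ k"
  let ?ps = "children ?R p"
  have R: "0 \<le> ?R"
    using assms(1) by simp
  have parent: "cball p (f * 4 ^ Suc k) = cball p (4 * ?R)"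
    by (simp add: mult_ac)
  have sub: "(\<Union>p'\<in>set ?ps. cball p' ?R) \<subseteq> cball p (f * 4 ^ Suc k)"
    using cball_children[OF R] unfolding parent by blast
  have "\<forall>p'\<in>set ?ps. fresh (opened_all A us) (cball p' ?R)"
    using fresh_mono[OF Suc.prems] sub by blast
  moreover have "?ps \<noteq> []"
    using length_children[of ?R p] by force
  ultimately obtain vs D N where
    vs: "attack f A k us (\<Union>p'\<in>set ?ps. cball p' ?R) vs D N" "length vs \<le> 5 * 5 ^ k" "vs \<noteq> []"
    and big: "N k = 5 \<or> (\<exists>(q, r)\<in>set D. ?R / 2 \<le> r)"
    using attack_siblings[OF Suc.IH separated_children[OF R], of us p]
    unfolding length_children by blast
  \<comment> \<open>The parent itself is the only visited disc of level \<open>Suc k\<close>; an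
    attack of height \<open>k\<close> says nothing about \<open>N (Suc k)\<close>.\<close>
  define M where "M = N(Suc k := 1)"
  have "M (Suc k) = 1"
    by (simp add: M_def)
  have sum_M: "1 / 5 * (\<Sum>j<k. 4 ^ j * real (N j)) + 4 ^ k * real (N k) \<le>
      (\<Sum>(q, r) \<leftarrow> D. charge f k r)"
    using vs(1) by (simp add: attack_def)
  let ?g = "\<lambda>r. if ?R / 2 \<le> r then 4 ^ Suc k else (0::real)"
  have charge_D: "(\<Sum>(q, r) \<leftarrow> D. charge f (Suc k) r) =
      (\<Sum>(q, r) \<leftarrow> D. charge f k r) + (\<Sum>(q, r) \<leftarrow> D. ?g r)"
    by (simp add: charge_Suc case_prod_unfold sum_list_addf)
  have g_nonneg: "0 \<le> (\<Sum>(q, r) \<leftarrow> D. ?g r)"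
    by (rule sum_list_nonneg) auto
  have M: "1 / 5 * (\<Sum>j<Suc k. 4 ^ j * real (M j)) + 4 ^ Suc k * real (M (Suc k)) =
      1 / 5 * (\<Sum>j<k. 4 ^ j * real (N j)) + 4 ^ k * real (N k) / 5 + 4 ^ Suc k"
    by (simp add: M_def add_divide_distrib)
  have charge_M: "1 / 5 * (\<Sum>j<Suc k. 4 ^ j * real (M j)) + 4 ^ Suc k * real (M (Suc k)) \<le>
      (\<Sum>(q, r) \<leftarrow> D. charge f (Suc k) r)"
    using big
  proof
    assume "N k = 5"
    \<comment> \<open>Once level \<open>k\<close> is no longer the top, its weight falls from 1 to
      1/5. With five children this frees four times \<open>4 ^ k\<close>, exactly the price of the
      parent.\<close>
    then have "4 ^ k * real (N k) / 5 + 4 ^ Suc k = 4 ^ k * real (N k)"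
      by simp
    then show ?thesis
      using M sum_M charge_D g_nonneg by linarith
  next
    assume "\<exists>(q, r)\<in>set D. ?R / 2 \<le> r"
    then obtain q r where "(q, r) \<in> set D" "?R / 2 \<le> r"
      by blast
    \<comment> \<open>Here the new charge term of one large cluster pays for the parent.\<close>
    then have "4 ^ Suc k \<in> set (map (\<lambda>(q, r). ?g r) D)"
      by force
    then have "4 ^ Suc k \<le> (\<Sum>(q, r) \<leftarrow> D. ?g r)"
      by (rule member_le_sum_list) auto
    moreover have "0 \<le> 4 ^ k * real (N k)"
      by simp
    ultimately show ?thesis
      using M sum_M charge_D by linarith
  qed
  have "\<exists>cs. length cs = M j \<and> set vs \<subseteq> (\<Union>c\<in>set cs. cball c (f * 4 ^ j))" if "j \<le> Suc k" for j
  proof (cases "j = Suc k")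
    case True
    then show ?thesis
      using vs(1) sub by (intro exI[of _ "[p]"]) (auto simp: attack_def M_def)
  next
    case False
    then show ?thesis
      using vs(1) that by (simp add: attack_def M_def)
  qed
  then have "attack f A (Suc k) us (cball p (f * 4 ^ Suc k)) vs D M"
    using attack_mono[OF vs(1) sub] charge_M unfolding attack_def by blast
  then show ?case
    using vs(2,3) \<open>M (Suc k) = 1\<close> by (intro exI[of _ vs] exI[of _ D] exI[of _ M]) simp
qed

section \<open>Lower bound by summing over the levels\<close>

lemma opt_cost_le_online_cost:
  assumes "0 < f" "valid_algorithm A"
  shows "\<exists>us. us \<noteq> [] \<and> length us \<le> 5 ^ k \<and> k * opt_cost f us \<le> 110 * online_cost f A us"
proof -
  obtain vs D N where vs: "attack f A k [] (cball 0 (f * 4 ^ k)) vs D N" "length vs \<le> 5 ^ k" "vs \<noteq> []"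
    using attack_exists[OF assms, of "[]" 0 k] by (auto simp: fresh_def)
  have D: "opened_all A vs = D" "\<forall>(q, r) \<in> set D. 0 \<le> r"
    using vs(1) by (auto simp: attack_def)
  have opt: "opt_cost f vs \<le> 2 * f * (4 ^ j * N j)" if j: "j < k" for j
  proof -
    obtain cs where "length cs = N j" "set vs \<subseteq> (\<Union>c\<in>set cs. cball c (f * 4 ^ j))"
      using vs(1) j unfolding attack_def by (meson less_imp_le)
    then have "opt_cost f vs \<le> N j * (f + f * 4 ^ j)"
      using opt_cost_le_cball_cover[where us = vs and cs = cs and f = f and R = "f * 4 ^ j"] vs(3) assms(1) by simp
    \<comment> \<open>The opening cost is absorbed by the radius, at the price of a factor
      2.\<close>
    also have "\<dots> \<le> N j * (f * 4 ^ j + f * 4 ^ j)"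
      using assms(1) by (intro mult_left_mono add_right_mono) auto
    finally show ?thesis
      by (simp add: algebra_simps)
  qed
  have "(\<Sum>j<k. 4 ^ j * real (N j)) \<le>
      5 * (1 / 5 * (\<Sum>j<k. 4 ^ j * real (N j)) + 4 ^ k * real (N k))"
    by simp
  also have "\<dots> \<le> 5 * (\<Sum>(q, r) \<leftarrow> D. charge f k r)"
    using vs(1) by (simp add: attack_def)
  also have "\<dots> \<le> 5 * (\<Sum>(q, r) \<leftarrow> D. 11 / f * (f + r))"
  proof -
    have "(case c of (q, r) \<Rightarrow> charge f k r) \<le> (case c of (q, r) \<Rightarrow> 11 / f * (f + r))"
      if "c \<in> set D" for c
      using charge_le_cost[OF assms(1)] D(2) that by fastforce
    then show ?thesis
      by (intro mult_left_mono sum_list_mono) auto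
  qed
  also have "\<dots> = 55 / f * online_cost f A vs"
    unfolding online_cost_def clustering_cost_def D(1) case_prod_unfold sum_list_const_mult
    by simp
  finally have total: "(\<Sum>j<k. 4 ^ j * real (N j)) \<le> 55 / f * online_cost f A vs" .
  \<comment> \<open>Each of the \<open>k\<close> levels bounds the same optimum. The constant 110 is
    2 from the covers, times 5 from the weight 1/5, times 11 from
    \<open>charge_le_cost\<close>.\<close>
  have "k * opt_cost f vs = (\<Sum>j<k. opt_cost f vs)"
    by simp
  also have "\<dots> \<le> (\<Sum>j<k. 2 * f * (4 ^ j * N j))"
    by (intro sum_mono) (use opt in auto)
  also have "\<dots> = 2 * f * (\<Sum>j<k. 4 ^ j * real (N j))"
    by (simp add: sum_distrib_left)
  also have "\<dots> \<le> 2 * f * (55 / f * online_cost f A vs)"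
    using total assms(1) by (intro mult_left_mono) auto
  also have "\<dots> = 110 * online_cost f A vs"
    using assms(1) by simp
  finally show ?thesis
    using vs(2,3) by blast
qed

lemma competitive_on_ge:
  assumes "0 < f" "valid_algorithm A" "competitive_on f A n c" "5 ^ k \<le> n"
  shows "real k \<le> 110 * c"
proof -
  obtain vs where vs: "vs \<noteq> []" "length vs \<le> 5 ^ k"
      "k * opt_cost f vs \<le> 110 * online_cost f A vs"
    using opt_cost_le_online_cost[OF assms(1,2)] by blast
  \<comment> \<open>\<open>competitive_on\<close> speaks of exactly \<open>n\<close> demands.
    Repeating an old demand keeps the set of demands, hence the optimum.\<close>
  define us where "us = vs @ replicate (n - length vs) (hd vs)"
  have "length us = n" "set us = set vs"
    using vs(1,2) assms(4) by (auto simp: us_def)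
  then have opt: "opt_cost f us = opt_cost f vs"
    by (simp add: opt_cost_def offline_solution_def)
  have "k * opt_cost f vs \<le> 110 * online_cost f A us"
    using vs(3) online_cost_append[OF assms(2), of f vs] assms(1) unfolding us_def
    by (smt (verit))
  also have "\<dots> \<le> 110 * (c * opt_cost f vs)"
    using assms(3) \<open>length us = n\<close> opt unfolding competitive_on_def by fastforce
  finally have "k * opt_cost f vs \<le> (110 * c) * opt_cost f vs"
    by simp
  moreover have "0 < opt_cost f vs"
    using opt_cost_ge[OF vs(1), of f] assms(1) by simp
  ultimately show ?thesis
    by (simp only: mult_le_cancel_right_pos)
qed

theorem theorem5:
  "\<exists>c::real. c > 0 \<and>
     (\<forall>\<^sub>F n in sequentially. \<forall>f::real. \<forall>A::online_algorithm.
        f > 0 \<longrightarrow> valid_algorithm A \<longrightarrow>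
          competitive_ratio f A n \<ge> ereal (c * ln (real n)))"
proof (rule exI[of _ "1 / 880"], intro conjI eventually_sequentiallyI[of 5] allI impI)
  fix n :: nat and f :: real and A :: online_algorithm
  assume n: "5 \<le> n" and f: "f > 0" and A: "valid_algorithm A"
  obtain k where k: "5 ^ k \<le> n" "n < 5 ^ (k + 1)"
    using ex_power_ivl1[of 5 n] n by auto
  \<comment> \<open>This allows \<open>k + 1 \<le> 2 * k\<close>. Together with
    \<open>ln 5 \<le> 4\<close> it gives the factor 8, and 880 is 110 times 8.\<close>
  have "1 \<le> k"
    using k(2) n by (cases k) auto
  have "real n \<le> 5 ^ (k + 1)"
    using k(2) by (metis less_imp_le of_nat_le_numeral_power_cancel_iff)
  then have "ln (real n) \<le> ln (5 ^ (k + 1))"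
    using n by simp
  also have "\<dots> = real (k + 1) * ln 5"
    by (subst ln_realpow) auto
  also have "\<dots> \<le> real (k + 1) * 4"
    using ln_le_minus_one[of "5::real"] by (intro mult_left_mono) auto
  also have "\<dots> \<le> 8 * k"
    using \<open>1 \<le> k\<close> by simp
  finally have "ln (real n) \<le> 8 * k" .
  then have "1 / 880 * ln (real n) \<le> c" if "competitive_on f A n c" for c
    using competitive_on_ge[OF f A that k(1)] by simp
  then show "ereal (1 / 880 * ln (real n)) \<le> competitive_ratio f A n"
    unfolding competitive_ratio_def by (intro Inf_greatest) auto
qed simp

end
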